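(* Given any $(\mu,N,K)$ SC-PIR system with $M=\mu N\in[2:N]$ an integer, let $$F^{(N,M)}_{\text{G-SDA}}=\eta\!\left(\tfrac{N}{\gcd(N,M)},\tfrac{M}{\gcd(N,M)}\right)\cdot(M-1).$$ Then (for $M<N$) the sub-packetization $F^{(N,M)}_{\text{G-SDA}}$ is within a multiplicative gap $\frac{\min\{M,N-M\}}{\gcd(N,M)}$ of the optimal sub-packetization $F^*$ of capacity-achieving linear SC-PIR schemes, i.e. $1\le F^{(N,M)}_{\text{G-SDA}}/F^*\le\frac{\min\{M,N-M\}}{\gcd(N,M)}$. In particular, in the cases $\min\{M,N-M\}\mid N$ or $M=N$, the sub-packetization $F^{(N,M)}_{\text{G-SDA}}=\frac{N(M-1)}{\gcd(N,M)}$ is optimal.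
   Context: Notation: $[a:b]=\{a,a+1,\dots,b\}$; entropies are in base $q$, where $q$ is a prime power; $A_{1:N}=(A_1,\dots,A_N)$; $\mathbf 1(x)=1$ if $x$ is true and $0$ otherwise. The function $\eta(N,M)$ is defined recursively for integers $1\le M\le N$ with $\gcd(N,M)=1$ by: $\eta(N,M)=1$ if $N=1$; $\eta(N,M)=1+\eta(N-M,M)$ if $N>1$ and $N\ge2M$; $\eta(N,M)=1+\eta(M,2M-N)$ if $N>1$ and $N<2M$. The number $F^{(N,M)}_{\text{G-SDA}}$ is the sub-packetization of a certain capacity-achieving linear $(\mu,N,K)$ SC-PIR scheme built from a greedily constructed storage array. A scheme for the $(\mu,N,K)$ SC-PIR (storage constrained private information retrieval) system, with $N$ servers, $K$ files and normalized storage capacity $\mu\in[1/N,1]$, consists of the following. Files: $W_1,\dots,W_K\in\mathbb F_q^{L}$ are independent, each made of $L$ i.i.d. uniform symbols (the file size $L$ may be arbitrarily large). Storage: each file $W_k$ is partitioned into $F$ disjoint packets $W_{k,1},\dots,W_{k,F}$, with $H(W_{k,i})$ not depending on $k$; $F$ is the sub-packetization. Server $n\in[1:N]$ stores $Z_n=\{W_{k,i}:k\in[1:K],i\in\mathcal Z_n\}$ for some $\mathcal Z_n\subseteq[1:F]$; every packet is stored at at least one server, and $H(Z_n)\le\mu KL$ for all $n$. Retrieval: for each desired index $\theta\in[1:K]$ there are random queries $Q_{1:N}^{[\theta]}$ and answers $A_{1:N}^{[\theta]}$ with $I(Q_{1:N}^{[\theta]};W_{1:K})=0$; $H(A_n^{[\theta]}|Q_n^{[\theta]},Z_n)=0$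 for all $n$; decodability $H(W_\theta|A_{1:N}^{[\theta]},Q_{1:N}^{[\theta]})=0$; and privacy: for every $n$, the distribution of $(Q_n^{[\theta]},A_n^{[\theta]},Z_n)$ does not depend on $\theta$. The retrieval rate is $R=L/D$, where $D=\sum_{n=1}^N H(A_n^{[\theta]})$ is the average download cost from the $N$ servers over random queries. The capacity $C^*$ is the supremum of achievable rates; for $M=\mu N\in[1:N]$ an integer it is known that $C^*=\left(1+\frac1M+\dots+\frac1{M^{K-1}}\right)^{-1}$. A scheme is capacity-achieving if its rate equals $C^*$. The scheme is linear if each answer has the form $A_n^{[\theta]}=(\mathbf{LC}_{n,1}^{[\theta]}(Z_n),\dots,\mathbf{LC}_{n,\ell_n}^{[\theta]}(Z_n))$ with $\mathbf{LC}_{n,j}^{[\theta]}(Z_n)=\sum_{k\in[1:K]}\sum_{i\in\mathcal Z_n}\beta_{n,k,i,j}^{[\theta]}W_{k,i}$, where $\ell_n$ is the answer length of the query $Q_n^{[\theta]}$ and the coefficients $\beta_{n,k,i,j}^{[\theta]}\in\mathbb F_q$ are determined completely by $Q_n^{[\theta]}$. Packets are represented by vectors over $\mathbb F_q$; packets of different dimensions are added after zero-padding to the largest dimension. Optimal sub-packetization: let $\eta^*$ be the minimum of $\sum_{\mathcal S\subseteq[1:N],|\mathcal S|=M}\mathbf 1(\alpha_{\mathcal S}>0)$ over families $\{\alpha_{\mathcal S}\}_{\mathcal S\subseteq[1:N],|\mathcal S|=M}$ with $0\le\alpha_{\mathcal S}\le1$ and $\sum_{|\mathcal S|=M,\,n\in\mathcal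 S}\alpha_{\mathcal S}=\mu$ for all $n\in[1:N]$. The optimal sub-packetization is $F^*=\eta^*\cdot(M-1)$, which is a lower bound on the sub-packetization of any capacity-achieving linear $(\mu,N,K)$ SC-PIR scheme and is attained; a sub-packetization is optimal if it equals $F^*$. *)

theory Defs
  imports Complex_Main
begin

text \<open>
  The recursion is only meant for \<open>1 \<le> M \<le> N\<close> with \<open>N\<close>, \<open>M\<close> coprime; the value \<open>0\<close> outside this
  domain is a dummy that is never reached from inside it.
\<close>

function eta :: "nat \<Rightarrow> nat \<Rightarrow> nat" where
  "eta N M =
    (if \<not> (1 \<le> M \<and> M \<le> N \<and> coprime N M) then 0
     else if N = 1 then 1
     else if N \<ge> 2 * M then 1 + eta (N - M) M
     else 1 + eta M (2 * M - N))"
  by auto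
termination
proof (relation "measure fst", goal_cases)
  case (3 N M)
  then have "M \<noteq> N" by auto
  with 3 show ?case by auto
qed auto

declare eta.simps [simp del]

lemma eta_recursion:
  assumes "1 \<le> M" "M \<le> N" "gcd N M = 1"
  shows "N = 1 \<Longrightarrow> eta N M = 1"
    and "N > 1 \<Longrightarrow> N \<ge> 2 * M \<Longrightarrow> eta N M = 1 + eta (N - M) M"
    and "N > 1 \<Longrightarrow> N < 2 * M \<Longrightarrow> eta N M = 1 + eta M (2 * M - N)"
  using assms by (subst eta.simps, simp add: coprime_iff_gcd_eq_1)+

lemma eta_domain:
  fixes N M :: nat
  assumes "1 \<le> M" "M \<le> N" "gcd N M = 1" "N > 1"
  shows "N \<ge> 2 * M \<Longrightarrow> 1 \<le> M \<and> M \<le> N - M \<and> gcd (N - M) M = 1"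
    and "N < 2 * M \<Longrightarrow> 1 \<le> 2 * M - N \<and> 2 * M - N \<le> M \<and> gcd M (2 * M - N) = 1"
proof -
  show "1 \<le> M \<and> M \<le> N - M \<and> gcd (N - M) M = 1" if "N \<ge> 2 * M"
    using assms that by (simp add: gcd_diff1_nat)
  show "1 \<le> 2 * M - N \<and> 2 * M - N \<le> M \<and> gcd M (2 * M - N) = 1" if "N < 2 * M"
  proof -
    have "gcd M (2 * M - N) = gcd (M - (N - M)) M"
      using assms(2) by (simp add: gcd.commute mult_2)
    also have "\<dots> = gcd (N - M) M"
      using that by (intro gcd_diff2_nat) simp
    also have "\<dots> = 1"
      using assms by (simp add: gcd_diff1_nat)
    finally have "gcd M (2 * M - N) = 1" .
    moreover have "1 \<le> 2 * M - N" "2 * M - N \<le> M" using that assms(2) by linarith+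
    ultimately show ?thesis by blast
  qed
qed

definition F_GSDA :: "nat \<Rightarrow> nat \<Rightarrow> nat" where
  "F_GSDA N M = eta (N div gcd N M) (M div gcd N M) * (M - 1)"

definition server_sets :: "nat \<Rightarrow> nat \<Rightarrow> nat set set" where
  "server_sets N M = {S. S \<subseteq> {1..N} \<and> card S = M}"

text \<open>
  \<open>\<alpha> S\<close> is the fraction of each file that is stored at exactly the servers in \<open>S\<close>.
\<close>

definition feasible :: "real \<Rightarrow> nat \<Rightarrow> nat \<Rightarrow> (nat set \<Rightarrow> real) \<Rightarrow> bool" where
  "feasible \<mu> N M \<alpha> \<longleftrightarrow>
     (\<forall>S\<in>server_sets N M. 0 \<le> \<alpha> S \<and> \<alpha> S \<le> 1) \<and>
     (\<forall>n\<in>{1..N}. (\<Sum>S | S \<in> server_sets N M \<and> n \<in> S. \<alpha> S) = \<mu>)"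

definition eta_star :: "real \<Rightarrow> nat \<Rightarrow> nat \<Rightarrow> nat" where
  "eta_star \<mu> N M =
     (LEAST m. \<exists>\<alpha>. feasible \<mu> N M \<alpha> \<and> m = (\<Sum>S\<in>server_sets N M. of_bool (\<alpha> S > 0)))"

definition F_star :: "real \<Rightarrow> nat \<Rightarrow> nat \<Rightarrow> nat" where
  "F_star \<mu> N M = eta_star \<mu> N M * (M - 1)"

definition optimal_subpacketization :: "real \<Rightarrow> nat \<Rightarrow> nat \<Rightarrow> nat \<Rightarrow> bool" where
  "optimal_subpacketization \<mu> N M F \<longleftrightarrow> F = F_star \<mu> N M"

lemma feasible_exists:
  assumes "1 \<le> M" "M \<le> N" "real M = \<mu> * real N"
  shows "\<exists>\<alpha>. feasible \<mu> N M \<alpha>"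
proof -
  have cnt: "card {S \<in> server_sets N M. n \<in> S} = (N - 1) choose (M - 1)" if n: "n \<in> {1..N}" for n
  proof -
    have "bij_betw (insert n) {T. T \<subseteq> {1..N} - {n} \<and> card T = M - 1} {S \<in> server_sets N M. n \<in> S}"
    proof (rule bij_betw_byWitness[where f' = "\<lambda>S. S - {n}"], goal_cases)
      case 3
      have "insert n T \<in> server_sets N M" if "T \<subseteq> {1..N} - {n}" "card T = M - 1" for T
      proof -
        have "finite T" "n \<notin> T" using that by (auto intro: finite_subset)
        then show ?thesis using that n assms by (auto simp: server_sets_def)
      qed
      then show ?case by blast
    qed (use n in \<open>auto simp: server_sets_def\<close>)
    then have "card {S \<in> server_sets N M. n \<in> S} = card {T. T \<subseteq> {1..N} - {n} \<and> card T = M - 1}"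
      by (rule bij_betw_same_card[symmetric])
    also have "\<dots> = (N - 1) choose (M - 1)"
      using n by (subst n_subsets) auto
    finally show ?thesis .
  qed
  have pos: "0 < N choose M" using assms by simp
  have "M * (N choose M) = N * ((N - 1) choose (M - 1))"
    using assms times_binomial_minus1_eq[of M N] by simp
  then have "real M * real (N choose M) = real N * real ((N - 1) choose (M - 1))"
    by (metis of_nat_mult)
  then have eq: "real ((N - 1) choose (M - 1)) * (1 / real (N choose M)) = \<mu>"
    using assms pos by (auto simp: field_simps)
  have "feasible \<mu> N M (\<lambda>_. 1 / real (N choose M))"
    unfolding feasible_def
  proof (intro conjI ballI)
    fix n assume "n \<in> {1..N}"
    then show "(\<Sum>S | S \<in> server_sets N M \<and> n \<in> S. 1 / real (N choose M)) = \<mu>"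
      by (subst sum_constant, subst cnt) (use eq in auto)
  qed (use pos in \<open>auto simp: field_simps Suc_le_eq\<close>)
  then show ?thesis by blast
qed

text \<open>
  Hence the \<open>LEAST\<close> in \<open>eta_star\<close> is a genuine, attained minimum.
\<close>

lemma eta_star_attained:
  assumes "1 \<le> M" "M \<le> N" "real M = \<mu> * real N"
  shows "\<exists>\<alpha>. feasible \<mu> N M \<alpha> \<and> eta_star \<mu> N M = (\<Sum>S\<in>server_sets N M. of_bool (\<alpha> S > 0))"
  unfolding eta_star_def by (rule LeastI_ex) (use feasible_exists[OF assms] in blast)

lemma eta_star_le:
  assumes "feasible \<mu> N M \<alpha>"
  shows "eta_star \<mu> N M \<le> (\<Sum>S\<in>server_sets N M. of_bool (\<alpha> S > 0))"
  unfolding eta_star_def by (rule Least_le) (use assms in blast)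

end

theory Submission
  imports Defs
begin

text \<open>
  The recursion for \<open>eta\<close> is realised by explicit storage designs. If \<open>2 M \<le> N\<close>, split off \<open>M\<close> servers
  as one block and solve \<open>(N - M, M)\<close> on the others; if \<open>N < 2 M\<close>, solve \<open>(M, 2 M - N)\<close> on \<open>M\<close> servers,
  enlarge all its blocks by the other \<open>N - M\<close> servers, and add the block of the \<open>M\<close> servers. Hence
  \<open>eta_star \<le> eta\<close>. Conversely the weights of a feasible family add up to \<open>1\<close>, so each server lies in
  some block of the support and, if \<open>M < N\<close>, outside some other one; counting gives
  \<open>N \<le> eta_star * min M (N - M)\<close>, while \<open>eta n m \<le> n\<close>.
\<close>

section \<open>Induction along the recursion, and values of \<open>eta\<close>\<close>

text \<open>Keeps the domain conditions out of later inductions: each case comes with its recursion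
  equation already unfolded. Coprimality leaves (1, 1) as the only pair with equal entries, which
  makes \<open>m < n\<close> strict in the last case.\<close>

lemma eta_induct [consumes 3, case_names one ge lt]:
  fixes n m :: nat
  assumes "1 \<le> m" "m \<le> n" "coprime n m"
    and one: "eta 1 1 = 1 \<Longrightarrow> P 1 1"
    and ge: "\<And>n m. 1 \<le> m \<Longrightarrow> 2 * m \<le> n \<Longrightarrow> eta n m = Suc (eta (n - m) m) \<Longrightarrow> P (n - m) m \<Longrightarrow> P n m"
    and lt: "\<And>n m. m < n \<Longrightarrow> n < 2 * m \<Longrightarrow> eta n m = Suc (eta m (2 * m - n)) \<Longrightarrow> P m (2 * m - n) \<Longrightarrow> P n m"
  shows "P n m"
  using assms(1-3)
proof (induction n m rule: eta.induct)
  case (1 n m)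
  have g: "gcd n m = 1" using "1.prems" by simp
  consider "n = 1" | "n > 1" "2 * m \<le> n" | "n > 1" "n < 2 * m"
    using "1.prems" by linarith
  then show ?case
  proof cases
    case 1
    with "1.prems" have "m = 1" by simp
    with 1 show ?thesis using one eta_recursion(1)[of 1 1] by simp
  next
    case 2
    have "P (n - m) m"
      using "1.IH"(1) 2 "1.prems" eta_domain(1)[OF "1.prems"(1,2) g 2]
      by (simp add: coprime_iff_gcd_eq_1)
    then show ?thesis
      using ge eta_recursion(2)[OF "1.prems"(1,2) g 2] "1.prems" 2 by simp
  next
    case 3
    have "m \<noteq> n" using 3 "1.prems" by auto
    moreover have "P m (2 * m - n)"
      using "1.IH"(2) 3 "1.prems" eta_domain(2)[OF "1.prems"(1,2) g 3]
      by (simp add: coprime_iff_gcd_eq_1)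
    ultimately show ?thesis
      using lt eta_recursion(3)[OF "1.prems"(1,2) g 3] "1.prems" 3 by simp
  qed
qed

text \<open>Each recursive step adds one to \<open>eta\<close> and lowers the first argument by at
  least one.\<close>

lemma eta_le:
  assumes "1 \<le> m" "m \<le> n" "coprime n m"
  shows "eta n m \<le> n"
  using assms by (induction rule: eta_induct) auto

text \<open>Together with \<open>eta_Suc_self\<close>, this gives the pairs at which
  \<open>eta_le\<close> is an equality and to which the special cases of the theorem reduce.\<close>

lemma eta_one_right: "1 \<le> n \<Longrightarrow> eta n 1 = n"
proof (induction n rule: nat_induct_at_least)
  case base
  show ?case using eta_recursion(1)[of 1 1] by simp
next
  case (Suc n)
  then show ?case using eta_recursion(2)[of 1 "Suc n"] by simp
qed

lemma eta_Suc_self: "1 \<le> n \<Longrightarrow> eta (Suc n) n = Suc n"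
proof (induction n rule: nat_induct_at_least)
  case base
  show ?case using eta_one_right[of 2] by (simp add: numeral_2_eq_2)
next
  case (Suc n)
  have "gcd (Suc (Suc n)) (Suc n) = 1"
    using coprime_Suc_left_nat[of "Suc n"] by (simp only: coprime_iff_gcd_eq_1)
  \<comment> \<open>The recursion thus sends a pair of consecutive numbers to the next lower such
    pair.\<close>
  moreover have "2 * Suc n - Suc (Suc n) = n" by simp
  ultimately show ?case
    using eta_recursion(3)[of "Suc n" "Suc (Suc n)"] Suc by simp
qed

section \<open>Storage designs with \<open>eta\<close> blocks\<close>

text \<open>The recursion lives on coprime pairs while \<open>N\<close> and \<open>M\<close> may
  share a divisor; hence all sizes are scaled by \<open>g\<close>, and the loads
  \<open>m / n\<close> stay the same. \<open>V\<close> is arbitrary because the induction hypothesis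
  is applied to a proper subset of it.\<close>

lemma design_exists:
  fixes V :: "'a set"
  assumes "1 \<le> m" "m \<le> n" "coprime n m" "g > 0" "finite V" "card V = g * n"
  shows "\<exists>\<A> w. finite \<A> \<and> (\<forall>S\<in>\<A>. S \<subseteq> V \<and> card S = g * m \<and> 0 \<le> w S) \<and> card \<A> = eta n m \<and>
           (\<forall>x\<in>V. (\<Sum>S\<in>\<A>. of_bool (x \<in> S) * w S) = real m / real n)"
  using assms
proof (induction arbitrary: V rule: eta_induct)
  case one
  then show ?case
    by (intro exI[of _ "{V}"] exI[of _ "\<lambda>_. 1"]) auto
next
  case (ge n m)
  obtain U where U: "U \<subseteq> V" "card U = g * m"
    using obtain_subset_with_card_n[of "g * m" V] ge.hyps ge.prems by auto
  let ?W = "V - U"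
  have finU: "finite U" using U ge.hyps ge.prems finite_subset by blast
  have cW: "card ?W = g * (n - m)"
    using U ge.hyps ge.prems finU by (simp add: card_Diff_subset diff_mult_distrib2)
  obtain \<A> w where \<A>: "finite \<A>" "\<And>S. S \<in> \<A> \<Longrightarrow> S \<subseteq> ?W \<and> card S = g * m \<and> 0 \<le> w S"
      "card \<A> = eta (n - m) m"
      "\<And>x. x \<in> ?W \<Longrightarrow> (\<Sum>S\<in>\<A>. of_bool (x \<in> S) * w S) = real m / real (n - m)"
    using ge.IH[OF ge.prems(1) finite_Diff[OF ge.prems(2)] cW] by blast
  \<comment> \<open>Servers of \<open>U\<close> lie in no other block, so \<open>U\<close> alone
    must supply the load \<open>m / n\<close>; the factor \<open>(n - m) / n\<close> turns the old
    load \<open>m / (n - m)\<close> of the others into \<open>m / n\<close>.\<close>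
  define w' where "w' S = (if S = U then real m / real n else real (n - m) / real n * w S)" for S
  have "U \<noteq> {}" using U ge.hyps ge.prems by auto
  then have notin: "U \<notin> \<A>" using \<A>(2) by blast
  have sum: "(\<Sum>S\<in>insert U \<A>. of_bool (x \<in> S) * w' S) =
      of_bool (x \<in> U) * (real m / real n) + real (n - m) / real n * (\<Sum>S\<in>\<A>. of_bool (x \<in> S) * w S)" for x
  proof -
    have "(\<Sum>S\<in>\<A>. of_bool (x \<in> S) * w' S) = real (n - m) / real n * (\<Sum>S\<in>\<A>. of_bool (x \<in> S) * w S)"
      unfolding sum_distrib_left by (rule sum.cong) (use notin in \<open>auto simp: w'_def\<close>)
    moreover have "w' U = real m / real n" by (simp add: w'_def)
    ultimately show ?thesis
      by (simp only: sum.insert[OF \<A>(1) notin])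
  qed
  show ?case
  proof (intro exI[of _ "insert U \<A>"] exI[of _ w'] conjI ballI)
    fix x assume x: "x \<in> V"
    show "(\<Sum>S\<in>insert U \<A>. of_bool (x \<in> S) * w' S) = real m / real n"
    proof (cases "x \<in> U")
      case True
      then have "(\<Sum>S\<in>\<A>. of_bool (x \<in> S) * w S) = 0"
        using \<A>(2) by (intro sum.neutral) auto
      then show ?thesis using True by (subst sum) simp
    next
      case False
      then show ?thesis using x \<A>(4)[of x] ge.hyps ge.prems by (subst sum) simp
    qed
  qed (use \<A> U notin ge.hyps ge.prems in \<open>auto simp: w'_def\<close>)
next
  case (lt n m)
  obtain W where W: "W \<subseteq> V" "card W = g * m"
    using obtain_subset_with_card_n[of "g * m" V] lt.hyps lt.prems by auto
  let ?U = "V - W"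
  have finW: "finite W" using W lt.hyps lt.prems finite_subset by blast
  have cU: "card ?U = g * (n - m)"
    using W lt.hyps lt.prems finW by (simp add: card_Diff_subset diff_mult_distrib2)
  obtain \<A> w where \<A>: "finite \<A>" "\<And>S. S \<in> \<A> \<Longrightarrow> S \<subseteq> W \<and> card S = g * (2 * m - n) \<and> 0 \<le> w S"
      "card \<A> = eta m (2 * m - n)"
      "\<And>x. x \<in> W \<Longrightarrow> (\<Sum>S\<in>\<A>. of_bool (x \<in> S) * w S) = real (2 * m - n) / real m"
    using lt.IH[OF lt.prems(1) finW W(2)] by blast
  \<comment> \<open>A server outside \<open>W\<close> lies in all enlarged blocks, so the total weight is needed as well.\<close>
  have total: "(\<Sum>S\<in>\<A>. w S) = 1"
  proof -
    \<comment> \<open>Double counting of server-block pairs: every block has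
      \<open>g * (2 * m - n)\<close> servers, and each of the \<open>g * m\<close> servers of
      \<open>W\<close> has load \<open>(2 * m - n) / m\<close>.\<close>
    have "real (g * (2 * m - n)) * (\<Sum>S\<in>\<A>. w S) = (\<Sum>S\<in>\<A>. \<Sum>x\<in>W. of_bool (x \<in> S) * w S)"
      unfolding sum_distrib_left
    proof (rule sum.cong)
      fix S assume "S \<in> \<A>"
      then have "W \<inter> S = S" "card S = g * (2 * m - n)" using \<A>(2) by auto
      then show "real (g * (2 * m - n)) * w S = (\<Sum>x\<in>W. of_bool (x \<in> S) * w S)"
        using finW by (simp flip: sum_distrib_right)
    qed simp
    also have "\<dots> = (\<Sum>x\<in>W. \<Sum>S\<in>\<A>. of_bool (x \<in> S) * w S)"
      by (rule sum.swap)
    also have "\<dots> = real (g * (2 * m - n))"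
      using \<A>(4) W lt.hyps lt.prems by simp
    finally show ?thesis using lt.hyps lt.prems by simp
  qed
  define f where "f S = S \<union> ?U" for S
  \<comment> \<open>Intersecting with \<open>W\<close> recovers the old block from an enlarged one.
    With scaling by \<open>m / n\<close>, a server outside \<open>W\<close> gets load
    \<open>m / n\<close> because the old weights total 1; a server in \<open>W\<close> gets
    \<open>(2 * m - n) / n\<close>, and the block \<open>W\<close> supplies the missing
    \<open>(n - m) / n\<close>.\<close>
  define w' where "w' S = (if S = W then real (n - m) / real n else real m / real n * w (S \<inter> W))" for S
  have inj: "inj_on f \<A>"
    using \<A>(2) by (intro inj_on_inverseI[where g = "\<lambda>S. S \<inter> W"]) (auto simp: f_def)
  \<comment> \<open>Every enlarged block contains the nonempty \<open>?U\<close>, so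
    \<open>W\<close> is not among them and accounts for the one added by the recursion.\<close>
  have "card ?U \<noteq> 0" unfolding cU using lt.hyps lt.prems by simp
  then have "?U \<noteq> {}" by (metis card.empty)
  then have fW: "f S \<noteq> W" for S by (auto simp: f_def)
  then have notin: "W \<notin> f ` \<A>" by blast
  have restr: "f S \<inter> W = S" if "S \<in> \<A>" for S using \<A>(2)[OF that] by (auto simp: f_def)
  have cf: "card (f S) = g * m" if "S \<in> \<A>" for S
  proof -
    have "S \<subseteq> W" "card S = g * (2 * m - n)" using \<A>(2) that by auto
    then have "card (f S) = g * (2 * m - n) + g * (n - m)"
      unfolding f_def using finW lt.prems cU by (subst card_Un_disjoint) (auto intro: finite_subset)
    also have "\<dots> = g * m" using lt.hyps lt.prems by (simp flip: add_mult_distrib2)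
    finally show ?thesis .
  qed
  have sum: "(\<Sum>S\<in>insert W (f ` \<A>). of_bool (x \<in> S) * w' S) =
      of_bool (x \<in> W) * (real (n - m) / real n) + real m / real n * (\<Sum>S\<in>\<A>. of_bool (x \<in> f S) * w S)" for x
  proof -
    have "(\<Sum>S\<in>f ` \<A>. of_bool (x \<in> S) * w' S) = real m / real n * (\<Sum>S\<in>\<A>. of_bool (x \<in> f S) * w S)"
      unfolding sum.reindex[OF inj] sum_distrib_left by (rule sum.cong) (use fW in \<open>auto simp: w'_def restr\<close>)
    moreover have "w' W = real (n - m) / real n" by (simp add: w'_def)
    ultimately show ?thesis
      by (simp only: sum.insert[OF finite_imageI[OF \<A>(1)] notin])
  qed
  show ?case
  proof (intro exI[of _ "insert W (f ` \<A>)"] exI[of _ w'] conjI ballI)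
    fix x assume x: "x \<in> V"
    show "(\<Sum>S\<in>insert W (f ` \<A>). of_bool (x \<in> S) * w' S) = real m / real n"
    proof (cases "x \<in> W")
      case True
      then have "x \<in> f S \<longleftrightarrow> x \<in> S" for S by (simp add: f_def)
      then have "(\<Sum>S\<in>\<A>. of_bool (x \<in> f S) * w S) = real (2 * m - n) / real m"
        using \<A>(4)[OF True] by (simp only:)
      moreover have "real (n - m) / real n + real m / real n * (real (2 * m - n) / real m) = real m / real n"
        using lt.hyps by (simp add: of_nat_diff flip: add_divide_distrib)
      ultimately show ?thesis
        unfolding sum using True by simp
    next
      case False
      then have "x \<in> f S" for S using x by (simp add: f_def)
      then show ?thesis using False total by (subst sum) simp
    qed
  next
    show "card (insert W (f ` \<A>)) = eta n m"
      using \<A>(1,3) notin card_image[OF inj] lt.hyps lt.prems by simp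
  next
    fix S assume "S \<in> insert W (f ` \<A>)"
    then show "S \<subseteq> V" "card S = g * m" "0 \<le> w' S"
      using W cf \<A>(2) fW restr by (auto simp: w'_def f_def)
  qed (use \<A>(1) in simp)
qed

section \<open>From designs to the upper bound on \<open>eta_star\<close>\<close>

lemma finite_server_sets: "finite (server_sets N M)"
  by (rule finite_subset[of _ "Pow {1..N}"]) (auto simp: server_sets_def)

lemma eta_star_le_eta:
  assumes "1 \<le> M" "M \<le> N" "real M = \<mu> * real N"
  shows "eta_star \<mu> N M \<le> eta (N div gcd N M) (M div gcd N M)"
proof -
  define g where "g = gcd N M"
  define n where "n = N div g"
  define m where "m = M div g"
  have g: "g > 0" "N = g * n" "M = g * m"
    using assms by (auto simp: g_def n_def m_def)
  have nm: "1 \<le> m" "m \<le> n" "coprime n m"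
  proof -
    show "1 \<le> m" using assms(1) g(3) by (cases m) auto
    show "m \<le> n" using assms(2) by (simp add: n_def m_def div_le_mono)
    show "coprime n m" using assms(1) unfolding n_def m_def g_def by (intro div_gcd_coprime) simp
  qed
  have cN: "card {1..N} = N" by simp
  obtain \<A> w where \<A>: "finite \<A>"
      "\<And>S. S \<in> \<A> \<Longrightarrow> S \<subseteq> {1..N} \<and> card S = M \<and> 0 \<le> w S"
      "card \<A> = eta n m"
      "\<And>x. x \<in> {1..N} \<Longrightarrow> (\<Sum>S\<in>\<A>. of_bool (x \<in> S) * w S) = real m / real n"
    using design_exists[OF nm g(1), of "{1..N}", folded g(2,3)] finite_atLeastAtMost[of 1 N] cN
    by blast
  have \<mu>: "\<mu> = real m / real n"
    using assms g nm by (simp add: field_simps)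
  \<comment> \<open>Extension by zero keeps the support inside \<open>\<A>\<close>.\<close>
  define \<alpha> where "\<alpha> S = of_bool (S \<in> \<A>) * w S" for S
  have sub: "\<A> \<subseteq> server_sets N M" using \<A>(2) by (auto simp: server_sets_def)
  \<comment> \<open>The design bounds weights only from below; but the weight of a block is part of
    the load \<open>m / n \<le> 1\<close> of any of its servers.\<close>
  have w_le: "w S \<le> 1" if S: "S \<in> \<A>" for S
  proof -
    have "S \<noteq> {}" using \<A>(2)[OF S] assms by auto
    then obtain x where x: "x \<in> S" "x \<in> {1..N}" using \<A>(2)[OF S] by blast
    have "w S = of_bool (x \<in> S) * w S" using x by simp
    also have "\<dots> \<le> (\<Sum>S\<in>\<A>. of_bool (x \<in> S) * w S)"
      using S \<A>(1,2) by (intro member_le_sum) auto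
    also have "\<dots> = real m / real n" using \<A>(4) x by simp
    also have "\<dots> \<le> 1" using nm by simp
    finally show ?thesis .
  qed
  have "feasible \<mu> N M \<alpha>"
    unfolding feasible_def
  proof (intro conjI ballI)
    fix x assume x: "x \<in> {1..N}"
    have "(\<Sum>S | S \<in> server_sets N M \<and> x \<in> S. \<alpha> S) = (\<Sum>S\<in>server_sets N M. of_bool (x \<in> S) * \<alpha> S)"
      by (rule sum.mono_neutral_cong_left) (auto simp: finite_server_sets)
    also have "\<dots> = (\<Sum>S\<in>\<A>. of_bool (x \<in> S) * w S)"
      by (rule sum.mono_neutral_cong_right) (use sub in \<open>auto simp: finite_server_sets \<alpha>_def\<close>)
    finally show "(\<Sum>S | S \<in> server_sets N M \<and> x \<in> S. \<alpha> S) = \<mu>"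
      using \<A>(4)[OF x] \<mu> by simp
  qed (use \<A>(2) w_le in \<open>auto simp: \<alpha>_def\<close>)
  then have "eta_star \<mu> N M \<le> (\<Sum>S\<in>server_sets N M. of_bool (\<alpha> S > 0))"
    by (rule eta_star_le)
  also have "\<dots> \<le> (\<Sum>S\<in>server_sets N M. of_bool (S \<in> \<A>))"
    by (rule sum_mono) (auto simp: \<alpha>_def)
  also have "\<dots> = card \<A>"
    using sub by (simp add: finite_server_sets Int_absorb1)
  finally show ?thesis using \<A>(3) by (simp add: n_def m_def g_def)
qed

section \<open>Lower bounds on \<open>eta_star\<close> by counting\<close>

text \<open>Double counting: every set has \<open>M\<close> servers and every server has load
  \<open>\<mu>\<close>, so \<open>M\<close> times the total weight is
  \<open>N * \<mu> = M\<close>.\<close>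

lemma feasible_sum_eq_1:
  assumes "feasible \<mu> N M \<alpha>" "1 \<le> M" "real M = \<mu> * real N"
  shows "(\<Sum>S\<in>server_sets N M. \<alpha> S) = 1"
proof -
  have "real M * (\<Sum>S\<in>server_sets N M. \<alpha> S) = (\<Sum>S\<in>server_sets N M. \<Sum>x | x \<in> {1..N} \<and> x \<in> S. \<alpha> S)"
    unfolding sum_distrib_left
  proof (rule sum.cong)
    fix S assume "S \<in> server_sets N M"
    then have "{x. x \<in> {1..N} \<and> x \<in> S} = S" "card S = M" by (auto simp: server_sets_def)
    then show "real M * \<alpha> S = (\<Sum>x | x \<in> {1..N} \<and> x \<in> S. \<alpha> S)" by simp
  qed simp
  also have "\<dots> = (\<Sum>x\<in>{1..N}. \<Sum>S | S \<in> server_sets N M \<and> x \<in> S. \<alpha> S)"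
    by (rule sum.swap_restrict) (auto simp: finite_server_sets)
  also have "\<dots> = real M"
    using assms by (simp add: feasible_def mult.commute)
  finally show ?thesis using assms(2) by simp
qed

lemma eta_star_ge:
  assumes "1 \<le> M" "M \<le> N" "real M = \<mu> * real N"
  shows "N \<le> eta_star \<mu> N M * M"
    and "M < N \<Longrightarrow> N \<le> eta_star \<mu> N M * (N - M)"
proof -
  obtain \<alpha> where \<alpha>: "feasible \<mu> N M \<alpha>"
      "eta_star \<mu> N M = (\<Sum>S\<in>server_sets N M. of_bool (\<alpha> S > 0))"
    using eta_star_attained[OF assms] by blast
  define P where "P = {S \<in> server_sets N M. \<alpha> S > 0}"
  have finP: "finite P" by (simp add: P_def finite_server_sets)
  have card: "eta_star \<mu> N M = card P"
    using \<alpha>(2) by (simp add: finite_server_sets P_def Int_def)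
  have "\<mu> * real N > 0" using assms(1) unfolding assms(3)[symmetric] by simp
  then have \<mu>: "\<mu> > 0" by (simp add: zero_less_mult_iff)
  have mem: "S \<subseteq> {1..N}" "card S = M" "finite S" if "S \<in> P" for S
    using that by (auto simp: P_def server_sets_def intro: finite_subset)
  have nonneg: "0 \<le> \<alpha> S" if "S \<in> server_sets N M" for S
    using \<alpha>(1) that by (simp add: feasible_def)
  have sum: "(\<Sum>S | S \<in> server_sets N M \<and> x \<in> S. \<alpha> S) = \<mu>" if "x \<in> {1..N}" for x
    using \<alpha>(1) that by (simp add: feasible_def)
  \<comment> \<open>A server outside all blocks of the support would have load 0.\<close>
  have "{1..N} \<subseteq> (\<Union>S\<in>P. S)"
  proof
    fix x assume x: "x \<in> {1..N}"
    show "x \<in> (\<Union>S\<in>P. S)"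
    proof (rule ccontr)
      assume "x \<notin> (\<Union>S\<in>P. S)"
      then have "(\<Sum>S | S \<in> server_sets N M \<and> x \<in> S. \<alpha> S) = 0"
        using nonneg by (intro sum.neutral) (force simp: P_def)
      then show False using sum[OF x] \<mu> by simp
    qed
  qed
  then have "card {1..N} \<le> card (\<Union>S\<in>P. S)"
    using finP mem(3) by (intro card_mono) auto
  also have "\<dots> \<le> (\<Sum>S\<in>P. card S)" by (rule card_UN_le[OF finP])
  also have "\<dots> = card P * M" using mem(2) by simp
  finally show "N \<le> eta_star \<mu> N M * M" by (simp add: card)
  assume less: "M < N"
  have \<mu>1: "\<mu> \<noteq> 1" using assms(3) less by auto
  \<comment> \<open>A server inside all blocks of the support would carry the total weight 1, but
    \<open>M < N\<close> excludes \<open>\<mu> = 1\<close>.\<close>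
  have "{1..N} \<subseteq> (\<Union>S\<in>P. {1..N} - S)"
  proof
    fix x assume x: "x \<in> {1..N}"
    show "x \<in> (\<Union>S\<in>P. {1..N} - S)"
    proof (rule ccontr)
      assume "x \<notin> (\<Union>S\<in>P. {1..N} - S)"
      then have "(\<Sum>S | S \<in> server_sets N M \<and> x \<in> S. \<alpha> S) = (\<Sum>S\<in>server_sets N M. \<alpha> S)"
        using nonneg x by (intro sum.mono_neutral_left) (force simp: P_def finite_server_sets)+
      then show False using sum[OF x] \<mu>1 feasible_sum_eq_1[OF \<alpha>(1) assms(1,3)] by simp
    qed
  qed
  then have "card {1..N} \<le> card (\<Union>S\<in>P. {1..N} - S)"
    using finP by (intro card_mono) auto
  also have "\<dots> \<le> (\<Sum>S\<in>P. card ({1..N} - S))" by (rule card_UN_le[OF finP])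
  also have "\<dots> = (\<Sum>S\<in>P. N - M)"
    by (rule sum.cong) (auto simp: card_Diff_subset mem simp del: One_nat_def)
  finally show "N \<le> eta_star \<mu> N M * (N - M)" by (simp add: card)
qed

section \<open>Special cases and the multiplicative gap\<close>

text \<open>Division by the gcd leaves a pair (k, 1) if \<open>M dvd N\<close>, which includes
  \<open>M = N\<close>, and a pair (k + 1, k) if \<open>N - M\<close> divides \<open>N\<close>. The
  value of the gcd lets the counting bound meet the upper bound.\<close>

lemma eta_eq_div_gcd:
  fixes N M :: nat
  assumes "1 \<le> M" "M \<le> N" "min M (N - M) dvd N \<or> M = N"
  shows "eta (N div gcd N M) (M div gcd N M) = N div gcd N M"
    and "M < N \<Longrightarrow> gcd N M = min M (N - M)"
proof -
  consider "M dvd N" | "M < N" "N - M \<le> M" "(N - M) dvd N"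
    using assms by (cases "M = N"; cases "M \<le> N - M") (auto simp: min_def)
  then have "eta (N div gcd N M) (M div gcd N M) = N div gcd N M \<and>
      (M < N \<longrightarrow> gcd N M = min M (N - M))"
  proof cases
    case 1
    then have g: "gcd N M = M" by (simp add: gcd_proj2_iff)
    have "1 \<le> N div M" using assms div_le_mono[of M N M] by simp
    moreover have "M \<le> N - M" if "M < N"
      using 1 that assms by (auto intro!: dvd_imp_le dvd_diff_nat)
    ultimately show ?thesis using g assms eta_one_right by simp
  next
    case 2
    define d where "d = N - M"
    have d: "d > 0" "N = M + d" using 2 by (auto simp: d_def)
    have "d dvd M" using 2 d by (simp flip: d_def)
    then obtain k where k: "M = d * k" by blast
    then have "N = d * Suc k" "k \<ge> 1" using d assms by auto
    moreover have "gcd (d * Suc k) (d * k) = d"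
      by (simp add: gcd_mult_distrib_nat[symmetric] del: mult_Suc_right)
    moreover have "min M (N - M) = d" using 2 by (simp add: d_def)
    ultimately show ?thesis using k d(1) eta_Suc_self[of k]
      by (simp del: mult_Suc_right)
  qed
  then show "eta (N div gcd N M) (M div gcd N M) = N div gcd N M"
    and "M < N \<Longrightarrow> gcd N M = min M (N - M)" by auto
qed

theorem theorem8:
  fixes \<mu> :: real and N K M :: nat
  assumes "K \<ge> 1"
    and "real M = \<mu> * real N"
    and "2 \<le> M" and "M \<le> N"
  shows "(M < N \<longrightarrow>
            1 \<le> real (F_GSDA N M) / real (F_star \<mu> N M) \<and>
            real (F_GSDA N M) / real (F_star \<mu> N M) \<le> real (min M (N - M)) / real (gcd N M)) \<and>
         (min M (N - M) dvd N \<or> M = N \<longrightarrow>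
            real (F_GSDA N M) = real N * (real M - 1) / real (gcd N M) \<and>
            optimal_subpacketization \<mu> N M (F_GSDA N M))"
proof -
  define g where "g = gcd N M"
  define e where "e = eta (N div g) (M div g)"
  define s where "s = eta_star \<mu> N M"
  have M1: "1 \<le> M" using assms by simp
  have g: "g > 0" "g dvd N" "g dvd M" using assms by (auto simp: g_def)
  have se: "s \<le> e"
    using eta_star_le_eta[OF M1 assms(4,2)] by (simp add: s_def e_def g_def)
  note lower = eta_star_ge[OF M1 assms(4,2), folded s_def]
  have s: "s > 0" using lower(1) assms by (cases "s = 0") auto
  have "1 \<le> M div g" using g M1 by (simp add: dvd_imp_le div_greater_zero_iff Suc_le_eq)
  then have e_le: "e \<le> N div g"
    unfolding e_def using assms div_gcd_coprime[of N M]
    by (intro eta_le) (auto simp: g_def intro: div_le_mono)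
  \<comment> \<open>The common factor \<open>M - 1\<close> is nonzero because
    \<open>2 \<le> M\<close>.\<close>
  have F: "real (F_GSDA N M) / real (F_star \<mu> N M) = real e / real s"
    using assms by (simp add: F_GSDA_def F_star_def e_def s_def g_def)
  have min: "N \<le> s * min M (N - M)" if "M < N"
    using lower that by (simp add: min_def)
  have "real e / real s \<le> real (min M (N - M)) / real g" if "M < N"
  proof -
    \<comment> \<open>Both sides are compared with \<open>N\<close>: \<open>e * g \<le> N\<close> by
      \<open>eta_le\<close>, and \<open>N\<close> is at most the right side by counting.\<close>
    have "e * g \<le> s * min M (N - M)"
      using mult_le_mono1[OF e_le, of g] g min[OF that] by simp
    then have "real e * real g \<le> real s * real (min M (N - M))"
      by (metis of_nat_le_iff of_nat_mult)
    then show ?thesis using s g by (simp add: field_simps)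
  qed
  moreover have "1 \<le> real e / real s" using s se by simp
  moreover have "real (F_GSDA N M) = real N * (real M - 1) / real g \<and> F_GSDA N M = F_star \<mu> N M"
    if special: "min M (N - M) dvd N \<or> M = N"
  proof -
    note eq = eta_eq_div_gcd[OF M1 assms(4) special, folded g_def, folded e_def]
    \<comment> \<open>For \<open>M < N\<close> the minimum in the counting bound equals
      \<open>g\<close>; for \<open>M = N\<close> the quotient is 1 and \<open>s > 0\<close>
      suffices.\<close>
    have "N div g \<le> s"
    proof (cases "M < N")
      case True
      then have "N \<le> s * g" using min eq(2) by simp
      then show ?thesis using g by (metis div_le_mono nonzero_mult_div_cancel_right not_gr0)
    next
      case False
      then show ?thesis using s assms by (simp add: g_def)
    qed
    then have "e = s" using se eq(1) by simp
    moreover have "real (F_GSDA N M) = real (N div g) * (real M - 1)"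
      using eq(1) M1 by (simp add: F_GSDA_def e_def g_def of_nat_diff)
    ultimately show ?thesis
      using g by (simp add: F_GSDA_def F_star_def e_def s_def g_def real_of_nat_div)
  qed
  ultimately show ?thesis
    unfolding F optimal_subpacketization_def g_def[symmetric] by blast
qed

end
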